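(* Any additive category $\mathbb{E}$ is $\mathrm{Equ}$-saturating.
   Context: An additive category here is a finitely complete category in which any object $X$ is endowed with a natural internal group structure $(X,+)$ (natural meaning that every morphism is a homomorphism; the structure is then unique and abelian, and the category is pointed). In a finitely complete category, a monomorphism $u:U\rightarrowtail X$ is saturated with respect to an internal equivalence relation $T$ on $X$ when the square formed by $u^{-1}T\to T$, $u$ and the projections $d_0$ (from $u^{-1}T$ to $U$ and from $T$ to $X$) is a pullback, where $u^{-1}T$ is the inverse image of $T$ along $u$. A finitely complete category is $\mathrm{Equ}$-saturating when, for any monomorphism $u:U\rightarrowtail X$ and any internal equivalence relation $S$ on $U$, among the internal equivalence relations $T$ on $X$ such that $u$ is saturated with respect to $T$ and $u^{-1}T\subset S$, there is a largest one. *)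

theory Defs
  imports Main
begin

section \<open>Categories\<close>

record ('o, 'a) cat =
  Obj :: "'o set"
  Arr :: "'a set"
  Dom :: "'a \<Rightarrow> 'o"
  Cod :: "'a \<Rightarrow> 'o"
  Ident :: "'o \<Rightarrow> 'a"
  Comp :: "'a \<Rightarrow> 'a \<Rightarrow> 'a"  (infixl "\<cdot>\<index>" 70)

text \<open>Composition is in applicative order: \<open>g \<cdot> f\<close> means first \<open>f\<close>, then \<open>g\<close>.
  It is only meaningful when \<open>Cod f = Dom g\<close>.\<close>

definition Hom :: "('o, 'a) cat \<Rightarrow> 'o \<Rightarrow> 'o \<Rightarrow> 'a set" where
  "Hom C x y = {f \<in> Arr C. Dom C f = x \<and> Cod C f = y}"

locale category =
  fixes C :: "('o, 'a) cat" (structure)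
  assumes Dom_in_Obj: "f \<in> Arr C \<Longrightarrow> Dom C f \<in> Obj C"
    and Cod_in_Obj: "f \<in> Arr C \<Longrightarrow> Cod C f \<in> Obj C"
    and Ident_in_Hom: "x \<in> Obj C \<Longrightarrow> Ident C x \<in> Hom C x x"
    and Comp_in_Hom: "\<lbrakk>f \<in> Hom C x y; g \<in> Hom C y z\<rbrakk> \<Longrightarrow> g \<cdot> f \<in> Hom C x z"
    and Comp_assoc: "\<lbrakk>f \<in> Hom C w x; g \<in> Hom C x y; h \<in> Hom C y z\<rbrakk>
          \<Longrightarrow> (h \<cdot> g) \<cdot> f = h \<cdot> (g \<cdot> f)"
    and Comp_Ident_left: "f \<in> Hom C x y \<Longrightarrow> Ident C y \<cdot> f = f"
    and Comp_Ident_right: "f \<in> Hom C x y \<Longrightarrow> f \<cdot> Ident C x = f"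

section \<open>Finite limits\<close>

definition is_functor ::
  "('i, 'b) cat \<Rightarrow> ('o, 'a) cat \<Rightarrow> ('i \<Rightarrow> 'o) \<Rightarrow> ('b \<Rightarrow> 'a) \<Rightarrow> bool" where
  "is_functor J C Fo Fa \<longleftrightarrow>
     (\<forall>j\<in>Obj J. Fo j \<in> Obj C) \<and>
     (\<forall>f\<in>Arr J. Fa f \<in> Hom C (Fo (Dom J f)) (Fo (Cod J f))) \<and>
     (\<forall>j\<in>Obj J. Fa (Ident J j) = Ident C (Fo j)) \<and>
     (\<forall>f\<in>Arr J. \<forall>g\<in>Arr J. Cod J f = Dom J g \<longrightarrow> Fa (g \<cdot>\<^bsub>J\<^esub> f) = Fa g \<cdot>\<^bsub>C\<^esub> Fa f)"

definition is_cone ::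
  "('i, 'b) cat \<Rightarrow> ('o, 'a) cat \<Rightarrow> ('i \<Rightarrow> 'o) \<Rightarrow> ('b \<Rightarrow> 'a) \<Rightarrow> 'o \<Rightarrow> ('i \<Rightarrow> 'a) \<Rightarrow> bool" where
  "is_cone J C Fo Fa L p \<longleftrightarrow>
     L \<in> Obj C \<and>
     (\<forall>j\<in>Obj J. p j \<in> Hom C L (Fo j)) \<and>
     (\<forall>f\<in>Arr J. Fa f \<cdot>\<^bsub>C\<^esub> p (Dom J f) = p (Cod J f))"

definition is_limit ::
  "('i, 'b) cat \<Rightarrow> ('o, 'a) cat \<Rightarrow> ('i \<Rightarrow> 'o) \<Rightarrow> ('b \<Rightarrow> 'a) \<Rightarrow> 'o \<Rightarrow> ('i \<Rightarrow> 'a) \<Rightarrow> bool" where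
  "is_limit J C Fo Fa L p \<longleftrightarrow>
     is_cone J C Fo Fa L p \<and>
     (\<forall>M q. is_cone J C Fo Fa M q \<longrightarrow>
        (\<exists>!h. h \<in> Hom C M L \<and> (\<forall>j\<in>Obj J. p j \<cdot>\<^bsub>C\<^esub> h = q j)))"

text \<open>Every finite category is isomorphic to one whose objects and arrows are natural numbers,
  so it suffices to let the diagram shapes range over the latter.\<close>

locale finitely_complete_category = category C
  for C :: "('o, 'a) cat" (structure) +
  assumes finite_limits:
    "\<And>(J :: (nat, nat) cat) Fo Fa.
       \<lbrakk>category J; finite (Obj J); finite (Arr J); is_functor J C Fo Fa\<rbrakk>
       \<Longrightarrow> \<exists>L p. is_limit J C Fo Fa L p"

context category
begin

definition monic :: "'o \<Rightarrow> 'o \<Rightarrow> 'a \<Rightarrow> bool" where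
  "monic U X u \<longleftrightarrow>
     u \<in> Hom C U X \<and>
     (\<forall>Z. \<forall>g\<in>Hom C Z U. \<forall>h\<in>Hom C Z U. u \<cdot> g = u \<cdot> h \<longrightarrow> g = h)"

definition is_terminal :: "'o \<Rightarrow> bool" where
  "is_terminal t \<longleftrightarrow> t \<in> Obj C \<and> (\<forall>X\<in>Obj C. \<exists>!f. f \<in> Hom C X t)"

definition is_product :: "'o \<Rightarrow> 'o \<Rightarrow> 'o \<Rightarrow> 'a \<Rightarrow> 'a \<Rightarrow> bool" where
  "is_product A B P p q \<longleftrightarrow>
     p \<in> Hom C P A \<and> q \<in> Hom C P B \<and>
     (\<forall>Z. \<forall>f\<in>Hom C Z A. \<forall>g\<in>Hom C Z B. \<exists>!h. h \<in> Hom C Z P \<and> p \<cdot> h = f \<and> q \<cdot> h = g)"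

text \<open>The commutative square with sides \<open>p : P \<rightarrow> A\<close>, \<open>f : A \<rightarrow> D\<close>, \<open>q : P \<rightarrow> B\<close>, \<open>g : B \<rightarrow> D\<close>
  is a pullback.\<close>

definition is_pullback :: "'a \<Rightarrow> 'a \<Rightarrow> 'a \<Rightarrow> 'a \<Rightarrow> bool" where
  "is_pullback p q f g \<longleftrightarrow>
     (\<exists>P A B D.
        p \<in> Hom C P A \<and> f \<in> Hom C A D \<and> q \<in> Hom C P B \<and> g \<in> Hom C B D \<and>
        f \<cdot> p = g \<cdot> q \<and>
        (\<forall>Z. \<forall>a\<in>Hom C Z A. \<forall>b\<in>Hom C Z B.
           f \<cdot> a = g \<cdot> b \<longrightarrow> (\<exists>!h. h \<in> Hom C Z P \<and> p \<cdot> h = a \<and> q \<cdot> h = b)))"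

text \<open>A choice of terminal object and binary products. It is only used in finitely complete
  categories, where these exist, and none of the notions defined from it depends on the
  choice (up to transport along the canonical isomorphisms).\<close>

definition one :: 'o where
  "one = (SOME t. is_terminal t)"

definition bang :: "'o \<Rightarrow> 'a" where
  "bang X = (THE f. f \<in> Hom C X one)"

definition product_cone :: "'o \<Rightarrow> 'o \<Rightarrow> 'o \<times> 'a \<times> 'a" where
  "product_cone A B = (SOME (P, p, q). is_product A B P p q)"

definition product :: "'o \<Rightarrow> 'o \<Rightarrow> 'o" where
  "product A B = fst (product_cone A B)"

definition pr0 :: "'o \<Rightarrow> 'o \<Rightarrow> 'a" where
  "pr0 A B = fst (snd (product_cone A B))"

definition pr1 :: "'o \<Rightarrow> 'o \<Rightarrow> 'a" where
  "pr1 A B = snd (snd (product_cone A B))"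

definition pair :: "'a \<Rightarrow> 'a \<Rightarrow> 'a" where
  "pair f g =
     (THE h. h \<in> Hom C (Dom C f) (product (Cod C f) (Cod C g)) \<and>
             pr0 (Cod C f) (Cod C g) \<cdot> h = f \<and> pr1 (Cod C f) (Cod C g) \<cdot> h = g)"

definition prod_map :: "'a \<Rightarrow> 'a \<Rightarrow> 'a" where
  "prod_map f g = pair (f \<cdot> pr0 (Dom C f) (Dom C g)) (g \<cdot> pr1 (Dom C f) (Dom C g))"

section \<open>Internal groups\<close>

text \<open>\<open>m : X \<times> X \<rightarrow> X\<close>, \<open>e : 1 \<rightarrow> X\<close>, \<open>i : X \<rightarrow> X\<close>. Associativity is an equation between arrows
  \<open>(X \<times> X) \<times> X \<rightarrow> X\<close>; its right-hand side includes the canonical map to \<open>X \<times> (X \<times> X)\<close>.\<close>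

definition internal_group :: "'o \<Rightarrow> 'a \<Rightarrow> 'a \<Rightarrow> 'a \<Rightarrow> bool" where
  "internal_group X m e i \<longleftrightarrow>
     X \<in> Obj C \<and> m \<in> Hom C (product X X) X \<and> e \<in> Hom C one X \<and> i \<in> Hom C X X \<and>
     m \<cdot> prod_map m (Ident C X) =
       m \<cdot> pair (pr0 X X \<cdot> pr0 (product X X) X)
                (m \<cdot> pair (pr1 X X \<cdot> pr0 (product X X) X) (pr1 (product X X) X)) \<and>
     m \<cdot> pair (e \<cdot> bang X) (Ident C X) = Ident C X \<and>
     m \<cdot> pair (Ident C X) (e \<cdot> bang X) = Ident C X \<and>
     m \<cdot> pair i (Ident C X) = e \<cdot> bang X \<and>
     m \<cdot> pair (Ident C X) i = e \<cdot> bang X"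

section \<open>Internal equivalence relations\<close>

text \<open>A relation on \<open>X\<close> is given by its two projections \<open>d0, d1 : T \<rightarrow> X\<close>, where
  \<open>T = Dom C d0 = Dom C d1\<close>.\<close>

definition internal_relation :: "'o \<Rightarrow> 'a \<Rightarrow> 'a \<Rightarrow> bool" where
  "internal_relation X d0 d1 \<longleftrightarrow>
     (\<exists>T. d0 \<in> Hom C T X \<and> d1 \<in> Hom C T X \<and>
        (\<forall>Z. \<forall>g\<in>Hom C Z T. \<forall>h\<in>Hom C Z T. d0 \<cdot> g = d0 \<cdot> h \<and> d1 \<cdot> g = d1 \<cdot> h \<longrightarrow> g = h))"

definition internal_equivalence :: "'o \<Rightarrow> 'a \<Rightarrow> 'a \<Rightarrow> bool" where
  "internal_equivalence X d0 d1 \<longleftrightarrow>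
     internal_relation X d0 d1 \<and>
     (\<exists>s\<in>Hom C X (Dom C d0). d0 \<cdot> s = Ident C X \<and> d1 \<cdot> s = Ident C X) \<and>
     (\<exists>s\<in>Hom C (Dom C d0) (Dom C d0). d0 \<cdot> s = d1 \<and> d1 \<cdot> s = d0) \<and>
     (\<forall>p q. is_pullback p q d1 d0 \<longrightarrow>
        (\<exists>t\<in>Hom C (Dom C p) (Dom C d0). d0 \<cdot> t = d0 \<cdot> p \<and> d1 \<cdot> t = d1 \<cdot> q))"

text \<open>Inclusion of relations on the same object: \<open>(r0, r1)\<close> factors through \<open>(s0, s1)\<close>.\<close>

definition relation_le :: "'a \<Rightarrow> 'a \<Rightarrow> 'a \<Rightarrow> 'a \<Rightarrow> bool" where
  "relation_le r0 r1 s0 s1 \<longleftrightarrow>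
     (\<exists>j\<in>Hom C (Dom C r0) (Dom C s0). s0 \<cdot> j = r0 \<and> s1 \<cdot> j = r1)"

text \<open>\<open>(r0, r1)\<close> together with the comparison \<open>w : R \<rightarrow> T\<close> is an inverse image of the relation
  \<open>(d0, d1)\<close> along \<open>u : U \<rightarrow> X\<close>: it is the pullback of \<open>T \<rightarrow> X \<times> X\<close> along \<open>u \<times> u\<close>.
  It is unique up to isomorphism.\<close>

definition inverse_image :: "'a \<Rightarrow> 'a \<Rightarrow> 'a \<Rightarrow> 'a \<Rightarrow> 'a \<Rightarrow> 'a \<Rightarrow> bool" where
  "inverse_image u d0 d1 r0 r1 w \<longleftrightarrow>
     (\<exists>R. r0 \<in> Hom C R (Dom C u) \<and> r1 \<in> Hom C R (Dom C u) \<and>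
        is_pullback (pair r0 r1) w (prod_map u u) (pair d0 d1))"

definition saturated :: "'a \<Rightarrow> 'a \<Rightarrow> 'a \<Rightarrow> bool" where
  "saturated u d0 d1 \<longleftrightarrow>
     (\<exists>r0 r1 w. inverse_image u d0 d1 r0 r1 w \<and> is_pullback r0 w u d0)"

definition inverse_image_le :: "'a \<Rightarrow> 'a \<Rightarrow> 'a \<Rightarrow> 'a \<Rightarrow> 'a \<Rightarrow> bool" where
  "inverse_image_le u d0 d1 s0 s1 \<longleftrightarrow>
     (\<exists>r0 r1 w. inverse_image u d0 d1 r0 r1 w \<and> relation_le r0 r1 s0 s1)"

end

section \<open>Additive and Equ-saturating categories\<close>

text \<open>Being a homomorphism of internal groups means commuting with the multiplications;
  compatibility with units and inverses follows.\<close>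

locale additive_category = finitely_complete_category C
  for C :: "('o, 'a) cat" (structure) +
  fixes add zero neg :: "'o \<Rightarrow> 'a"
  assumes group_structure:
    "X \<in> Obj C \<Longrightarrow> internal_group X (add X) (zero X) (neg X)"
    and natural: "f \<in> Hom C X Y \<Longrightarrow> f \<cdot> add X = add Y \<cdot> prod_map f f"

locale Equ_saturating_category = finitely_complete_category C
  for C :: "('o, 'a) cat" (structure) +
  assumes largest_saturating:
    "\<lbrakk>monic U X u; internal_equivalence U s0 s1\<rbrakk> \<Longrightarrow>
     \<exists>t0 t1.
       internal_equivalence X t0 t1 \<and> saturated u t0 t1 \<and> inverse_image_le u t0 t1 s0 s1 \<and>
       (\<forall>d0 d1.
          internal_equivalence X d0 d1 \<and> saturated u d0 d1 \<and> inverse_image_le u d0 d1 s0 s1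
          \<longrightarrow> relation_le d0 d1 t0 t1)"

end

theory Submission
  imports Defs
begin

text \<open>In an additive category every hom-set carries a group structure, bilinear for composition,
  and an equivalence relation \<open>T\<close> on \<open>X\<close> is determined by the subobject of those \<open>x\<close> with \<open>0 T x\<close>.
  Let \<open>k : I \<rightarrow> U\<close> be this subobject for \<open>S\<close>. If \<open>u\<close> is saturated with respect to \<open>T\<close>
  and \<open>u\<^sup>-\<^sup>1T \<subseteq> S\<close>, then the class of zero of \<open>T\<close> lies in \<open>U\<close>, and hence in \<open>I\<close>. So the largest such
  \<open>T\<close> is the congruence modulo \<open>u k : I \<rightarrow> X\<close>, realised as \<open>X \<times> I\<close> with projections
  \<open>x\<close> and \<open>x + u k i\<close>.\<close>

section \<open>Hom-sets and pullbacks\<close>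

context category
begin

lemma Hom_Obj:
  assumes "f \<in> Hom C X Y" shows "X \<in> Obj C" "Y \<in> Obj C"
  using assms Dom_in_Obj Cod_in_Obj by (auto simp: Hom_def)

lemma Hom_DomCod:
  assumes "f \<in> Hom C X Y" shows "Dom C f = X" "Cod C f = Y"
  using assms by (auto simp: Hom_def)

lemma Ident_Ident: "X \<in> Obj C \<Longrightarrow> Ident C X \<cdot> Ident C X = Ident C X"
  using Comp_Ident_left[OF Ident_in_Hom] .

text \<open>The definition hides all four corners behind an existential. Domains and codomains
  determine them from the arrows, so once \<open>f\<close> and \<open>g\<close> are typed only the
  apex \<open>P\<close> remains to be named.\<close>

lemma is_pullbackE:
  assumes "is_pullback p q f g" "f \<in> Hom C A D" "g \<in> Hom C B D"
  obtains P where "p \<in> Hom C P A" "q \<in> Hom C P B" "f \<cdot> p = g \<cdot> q"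
    "\<And>Z a b. \<lbrakk>a \<in> Hom C Z A; b \<in> Hom C Z B; f \<cdot> a = g \<cdot> b\<rbrakk>
       \<Longrightarrow> \<exists>!h. h \<in> Hom C Z P \<and> p \<cdot> h = a \<and> q \<cdot> h = b"
proof -
  obtain P A' B' D' where P: "p \<in> Hom C P A'" "f \<in> Hom C A' D'" "q \<in> Hom C P B'"
      "g \<in> Hom C B' D'" "f \<cdot> p = g \<cdot> q"
    and univ: "\<forall>Z. \<forall>a\<in>Hom C Z A'. \<forall>b\<in>Hom C Z B'.
           f \<cdot> a = g \<cdot> b \<longrightarrow> (\<exists>!h. h \<in> Hom C Z P \<and> p \<cdot> h = a \<and> q \<cdot> h = b)"
    using assms(1) unfolding is_pullback_def by blast
  have "A' = A" "B' = B"
    using P assms by (auto simp: Hom_def)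
  with P univ show thesis
    by (intro that[of P]) auto
qed

lemma is_pullbackI:
  assumes "p \<in> Hom C P A" "f \<in> Hom C A D" "q \<in> Hom C P B" "g \<in> Hom C B D" "f \<cdot> p = g \<cdot> q"
    and "\<And>Z a b. \<lbrakk>a \<in> Hom C Z A; b \<in> Hom C Z B; f \<cdot> a = g \<cdot> b\<rbrakk>
       \<Longrightarrow> \<exists>!h. h \<in> Hom C Z P \<and> p \<cdot> h = a \<and> q \<cdot> h = b"
  shows "is_pullback p q f g"
  unfolding is_pullback_def using assms by blast

end

section \<open>Terminal object, binary products and equalizers as limits of small diagrams\<close>

context finitely_complete_category
begin

text \<open>A cone over the empty diagram is just its apex, so the limit of that diagram is
  terminal.\<close>

lemma terminal_exists: "\<exists>t. is_terminal t"
proof -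
  define J :: "(nat, nat) cat" where
    "J = \<lparr>Obj = {}, Arr = {}, Dom = id, Cod = id, Ident = id, Comp = (\<lambda>g f. f)\<rparr>"
  have cat: "category J"
    by unfold_locales (auto simp: J_def Hom_def)
  \<comment> \<open>\<open>J\<close> has no objects or arrows, so every pair of functions is a
    functor; this is why \<open>undefined\<close> can serve as the diagram.\<close>
  have fctr: "is_functor J C Fo Fa" for Fo Fa
    by (simp add: is_functor_def J_def)
  have "finite (Obj J)" "finite (Arr J)"
    by (simp_all add: J_def)
  then obtain L p where L: "is_limit J C (\<lambda>_. undefined) (\<lambda>_. undefined) L p"
    using finite_limits[OF cat _ _ fctr] by blast
  have "is_cone J C (\<lambda>_. undefined) (\<lambda>_. undefined) M q \<longleftrightarrow> M \<in> Obj C" for M q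
    by (simp add: is_cone_def J_def)
  with L have "is_terminal L"
    by (auto simp: is_limit_def is_terminal_def J_def)
  then show ?thesis ..
qed

text \<open>The limit over the discrete category on \<open>0\<close> and \<open>1\<close>.
  Composable arrows there are equal, so returning either argument is a valid composition.\<close>

lemma product_exists:
  assumes "A \<in> Obj C" "B \<in> Obj C"
  shows "\<exists>P p q. is_product A B P p q"
proof -
  define J :: "(nat, nat) cat" where
    "J = \<lparr>Obj = {0,1}, Arr = {0,1}, Dom = id, Cod = id, Ident = id, Comp = (\<lambda>g f. f)\<rparr>"
  define Fo where "Fo j = (if j = (0::nat) then A else B)" for j
  define Fa where "Fa j = Ident C (Fo j)" for j
  have Fo: "Fo j \<in> Obj C" for j
    using assms by (simp add: Fo_def)
  have cat: "category J"
    by unfold_locales (auto simp: J_def Hom_def)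
  have fctr: "is_functor J C Fo Fa"
    by (simp add: is_functor_def J_def Fa_def Fo Ident_in_Hom Ident_Ident)
  have "finite (Obj J)" "finite (Arr J)"
    by (simp_all add: J_def)
  then obtain L p where L: "is_limit J C Fo Fa L p"
    using finite_limits[OF cat _ _ fctr] by blast
  have cone: "is_cone J C Fo Fa M q \<longleftrightarrow> q 0 \<in> Hom C M A \<and> q 1 \<in> Hom C M B" for M q
    by (auto simp: is_cone_def J_def Fa_def Fo_def Comp_Ident_left intro: Hom_Obj(1))
  have "is_product A B L (p 0) (p 1)"
    unfolding is_product_def
  proof (intro conjI allI ballI)
    show "p 0 \<in> Hom C L A" "p 1 \<in> Hom C L B"
      using L cone by (auto simp: is_limit_def)
    fix Z f g assume "f \<in> Hom C Z A" "g \<in> Hom C Z B"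
    then have "is_cone J C Fo Fa Z (\<lambda>j. if j = 0 then f else g)"
      by (simp add: cone)
    then have "\<exists>!h. h \<in> Hom C Z L \<and> (\<forall>j\<in>Obj J. p j \<cdot> h = (if j = 0 then f else g))"
      using L unfolding is_limit_def by blast
    then show "\<exists>!h. h \<in> Hom C Z L \<and> p 0 \<cdot> h = f \<and> p 1 \<cdot> h = g"
      by (simp add: J_def)
  qed
  then show ?thesis by blast
qed

text \<open>The limit over a parallel pair. The leg at \<open>1\<close> of any cone is
  \<open>f\<close> after the leg at \<open>0\<close>, so a cone amounts to an arrow equalizing
  \<open>f\<close> and \<open>g\<close>.\<close>

lemma equalizer_exists:
  assumes f: "f \<in> Hom C A B" and g: "g \<in> Hom C A B"
  obtains K k where "k \<in> Hom C K A" "f \<cdot> k = g \<cdot> k"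
    "\<And>Z a. \<lbrakk>a \<in> Hom C Z A; f \<cdot> a = g \<cdot> a\<rbrakk> \<Longrightarrow> \<exists>!h. h \<in> Hom C Z K \<and> k \<cdot> h = a"
proof -
  \<comment> \<open>objects \<open>0, 1\<close> with identities \<open>0, 1\<close>, and parallel arrows \<open>2, 3 : 0 \<rightarrow> 1\<close>\<close>
  define J :: "(nat, nat) cat" where
    "J = \<lparr>Obj = {0,1}, Arr = {0,1,2,3}, Dom = (\<lambda>a. if a = 1 then 1 else 0),
          Cod = (\<lambda>a. if a = 0 then 0 else 1), Ident = id,
          Comp = (\<lambda>g f. if f \<le> 1 then g else f)\<rparr>"
  define Fo where "Fo j = (if j = (0::nat) then A else B)" for j
  define Fa where
    "Fa a = (if a = (0::nat) then Ident C A else if a = 1 then Ident C B else if a = 2 then f else g)"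
    for a
  note AB = Hom_Obj[OF f]
  \<comment> \<open>An arrow of \<open>J\<close> that is at most \<open>1\<close> is an identity,
    and then the composite is the other arrow. An arrow \<open>2\<close> or \<open>3\<close> ends at
    \<open>1\<close>, so only the identity \<open>1\<close> can follow it.\<close>
  have cat: "category J"
  proof
    fix h g f :: nat and w x y z
    show "h \<cdot>\<^bsub>J\<^esub> g \<cdot>\<^bsub>J\<^esub> f = h \<cdot>\<^bsub>J\<^esub> (g \<cdot>\<^bsub>J\<^esub> f)"
      by (simp add: J_def)
    show "f \<in> Hom J x y \<Longrightarrow> g \<in> Hom J y z \<Longrightarrow> g \<cdot>\<^bsub>J\<^esub> f \<in> Hom J x z"
      by (cases "f \<le> 1") (auto simp: J_def Hom_def)
  qed (auto simp: J_def Hom_def)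
  have fctr: "is_functor J C Fo Fa"
    using f g AB
    by (simp add: is_functor_def J_def Fo_def Fa_def Ident_in_Hom Ident_Ident
        Comp_Ident_left[OF f] Comp_Ident_left[OF g] Comp_Ident_right[OF f] Comp_Ident_right[OF g])
  have "finite (Obj J)" "finite (Arr J)"
    by (simp_all add: J_def)
  then obtain L p where L: "is_limit J C Fo Fa L p"
    using finite_limits[OF cat _ _ fctr] by blast
  have cone: "is_cone J C Fo Fa M q \<longleftrightarrow>
      q 0 \<in> Hom C M A \<and> q 1 \<in> Hom C M B \<and> f \<cdot> q 0 = q 1 \<and> g \<cdot> q 0 = q 1" for M q
    by (auto simp: is_cone_def J_def Fa_def Fo_def Comp_Ident_left intro: Hom_Obj(1))
  have p: "p 0 \<in> Hom C L A" "p 1 \<in> Hom C L B" "f \<cdot> p 0 = p 1" "g \<cdot> p 0 = p 1"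
    using L cone by (auto simp: is_limit_def)
  show thesis
  proof (rule that[of "p 0" L])
    show "p 0 \<in> Hom C L A" "f \<cdot> p 0 = g \<cdot> p 0"
      using p by auto
    fix Z a assume a: "a \<in> Hom C Z A" "f \<cdot> a = g \<cdot> a"
    then have "is_cone J C Fo Fa Z (\<lambda>j. if j = 0 then a else f \<cdot> a)"
      using Comp_in_Hom[OF a(1) g] by (simp add: cone)
    then have "\<exists>!h. h \<in> Hom C Z L \<and> (\<forall>j\<in>Obj J. p j \<cdot> h = (if j = 0 then a else f \<cdot> a))"
      using L unfolding is_limit_def by blast
    \<comment> \<open>The equation at \<open>1\<close> follows from the one at \<open>0\<close>,
      because \<open>p 1\<close> is \<open>f \<cdot> p 0\<close>.\<close>
    moreover have "(\<forall>j\<in>Obj J. p j \<cdot> h = (if j = 0 then a else f \<cdot> a)) \<longleftrightarrow> p 0 \<cdot> h = a"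
      if "h \<in> Hom C Z L" for h
      using Comp_assoc[OF that p(1) f] p(3) by (auto simp: J_def)
    ultimately show "\<exists>!h. h \<in> Hom C Z L \<and> p 0 \<cdot> h = a"
      by (metis (no_types, lifting))
  qed
qed

section \<open>Calculus of the chosen terminal object and products\<close>

lemma one_terminal: "is_terminal one"
  unfolding one_def using terminal_exists by (rule someI_ex)

lemma bang_Hom: "X \<in> Obj C \<Longrightarrow> bang X \<in> Hom C X one"
  unfolding bang_def using one_terminal theI'[of "\<lambda>f. f \<in> Hom C X one"]
  by (simp add: is_terminal_def)

lemma to_one_unique: "\<lbrakk>f \<in> Hom C X one; g \<in> Hom C X one\<rbrakk> \<Longrightarrow> f = g"
  using one_terminal Hom_Obj(1) unfolding is_terminal_def by blast

lemma product_is_product: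
  assumes "A \<in> Obj C" "B \<in> Obj C"
  shows "is_product A B (product A B) (pr0 A B) (pr1 A B)"
proof -
  have "\<exists>x. case x of (P, p, q) \<Rightarrow> is_product A B P p q"
    using product_exists[OF assms] by auto
  then have "case product_cone A B of (P, p, q) \<Rightarrow> is_product A B P p q"
    unfolding product_cone_def by (rule someI_ex)
  then show ?thesis
    by (simp add: product_def pr0_def pr1_def split_beta)
qed

lemma pr_Hom:
  assumes "A \<in> Obj C" "B \<in> Obj C"
  shows "pr0 A B \<in> Hom C (product A B) A" "pr1 A B \<in> Hom C (product A B) B"
  using product_is_product[OF assms] by (auto simp: is_product_def)

lemma pair_props:
  assumes f: "f \<in> Hom C Z A" and g: "g \<in> Hom C Z B"
  shows pair_Hom: "pair f g \<in> Hom C Z (product A B)"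
    and pr0_pair: "pr0 A B \<cdot> pair f g = f"
    and pr1_pair: "pr1 A B \<cdot> pair f g = g"
proof -
  have "\<exists>!h. h \<in> Hom C Z (product A B) \<and> pr0 A B \<cdot> h = f \<and> pr1 A B \<cdot> h = g"
    using product_is_product[OF Hom_Obj(2)[OF f] Hom_Obj(2)[OF g]] f g
    unfolding is_product_def by blast
  from theI'[OF this]
  show "pair f g \<in> Hom C Z (product A B)" "pr0 A B \<cdot> pair f g = f" "pr1 A B \<cdot> pair f g = g"
    using Hom_DomCod[OF f] Hom_DomCod[OF g] by (auto simp: pair_def)
qed

lemma product_ext:
  assumes "h \<in> Hom C Z (product A B)" "h' \<in> Hom C Z (product A B)" "A \<in> Obj C" "B \<in> Obj C"
    and "pr0 A B \<cdot> h = pr0 A B \<cdot> h'" "pr1 A B \<cdot> h = pr1 A B \<cdot> h'"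
  shows "h = h'"
proof -
  have "pr0 A B \<cdot> h \<in> Hom C Z A" "pr1 A B \<cdot> h \<in> Hom C Z B"
    using Comp_in_Hom[OF assms(1) pr_Hom(1)[OF assms(3,4)]]
      Comp_in_Hom[OF assms(1) pr_Hom(2)[OF assms(3,4)]] .
  then have "\<exists>!k. k \<in> Hom C Z (product A B) \<and> pr0 A B \<cdot> k = pr0 A B \<cdot> h \<and> pr1 A B \<cdot> k = pr1 A B \<cdot> h"
    using product_is_product assms(3,4) unfolding is_product_def by blast
  then show ?thesis
    using assms by metis
qed

lemma pair_comp:
  assumes f: "f \<in> Hom C Z A" and g: "g \<in> Hom C Z B" and h: "h \<in> Hom C W Z"
  shows "pair f g \<cdot> h = pair (f \<cdot> h) (g \<cdot> h)"
proof -
  have o: "A \<in> Obj C" "B \<in> Obj C"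
    using f g Hom_Obj by auto
  have fh: "f \<cdot> h \<in> Hom C W A" "g \<cdot> h \<in> Hom C W B"
    using Comp_in_Hom[OF h f] Comp_in_Hom[OF h g] .
  show ?thesis
    using Comp_in_Hom[OF h pair_Hom[OF f g]] pair_Hom[OF fh] o
  proof (rule product_ext)
    show "pr0 A B \<cdot> (pair f g \<cdot> h) = pr0 A B \<cdot> pair (f \<cdot> h) (g \<cdot> h)"
      using Comp_assoc[OF h pair_Hom[OF f g] pr_Hom(1)[OF o]] pr0_pair f g fh by simp
    show "pr1 A B \<cdot> (pair f g \<cdot> h) = pr1 A B \<cdot> pair (f \<cdot> h) (g \<cdot> h)"
      using Comp_assoc[OF h pair_Hom[OF f g] pr_Hom(2)[OF o]] pr1_pair f g fh by simp
  qed
qed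

lemma pair_eq_iff:
  assumes "f \<in> Hom C Z A" "g \<in> Hom C Z B" "f' \<in> Hom C Z A" "g' \<in> Hom C Z B"
  shows "pair f g = pair f' g' \<longleftrightarrow> f = f' \<and> g = g'"
  using pr0_pair[OF assms(1,2)] pr1_pair[OF assms(1,2)] pr0_pair[OF assms(3,4)] pr1_pair[OF assms(3,4)]
  by auto

text \<open>Lets an arrow into a product be treated as a pair of generalized elements, which is how
  later arguments about products compute.\<close>

lemma pair_surj:
  assumes "h \<in> Hom C Z (product A B)" "A \<in> Obj C" "B \<in> Obj C"
  obtains f g where "f \<in> Hom C Z A" "g \<in> Hom C Z B" "h = pair f g"
proof (rule that)
  show f: "pr0 A B \<cdot> h \<in> Hom C Z A" and g: "pr1 A B \<cdot> h \<in> Hom C Z B"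
    using Comp_in_Hom[OF assms(1) pr_Hom(1)[OF assms(2,3)]]
      Comp_in_Hom[OF assms(1) pr_Hom(2)[OF assms(2,3)]] .
  show "h = pair (pr0 A B \<cdot> h) (pr1 A B \<cdot> h)"
    using product_ext[OF assms(1) pair_Hom[OF f g] assms(2,3)] pr0_pair[OF f g] pr1_pair[OF f g]
    by simp
qed

lemma prod_map_Hom:
  assumes f: "f \<in> Hom C A A'" and g: "g \<in> Hom C B B'"
  shows "prod_map f g \<in> Hom C (product A B) (product A' B')"
  unfolding prod_map_def Hom_DomCod[OF f] Hom_DomCod[OF g]
  using pair_Hom[OF Comp_in_Hom[OF pr_Hom(1) f] Comp_in_Hom[OF pr_Hom(2) g]]
    Hom_Obj(1)[OF f] Hom_Obj(1)[OF g] by blast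

lemma prod_map_pair:
  assumes f: "f \<in> Hom C A A'" and g: "g \<in> Hom C B B'"
    and a: "a \<in> Hom C Z A" and b: "b \<in> Hom C Z B"
  shows "prod_map f g \<cdot> pair a b = pair (f \<cdot> a) (g \<cdot> b)"
proof -
  note pr = pr_Hom[OF Hom_Obj(1)[OF f] Hom_Obj(1)[OF g]]
  have "prod_map f g \<cdot> pair a b = pair (f \<cdot> pr0 A B \<cdot> pair a b) (g \<cdot> pr1 A B \<cdot> pair a b)"
    unfolding prod_map_def Hom_DomCod[OF f] Hom_DomCod[OF g]
    using pair_comp[OF Comp_in_Hom[OF pr(1) f] Comp_in_Hom[OF pr(2) g] pair_Hom[OF a b]] .
  then show ?thesis
    using Comp_assoc[OF pair_Hom[OF a b] pr(1) f] Comp_assoc[OF pair_Hom[OF a b] pr(2) g]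
      pr0_pair[OF a b] pr1_pair[OF a b] by simp
qed

section \<open>Inverse images of relations in terms of generalized elements\<close>

text \<open>Reading the pullback over \<open>product X X\<close> componentwise removes the products:
  an element of the inverse image is a triple of \<open>a\<close>, \<open>b\<close> in
  \<open>U\<close> and \<open>c\<close> in \<open>T\<close> relating \<open>u \<cdot> a\<close> to
  \<open>u \<cdot> b\<close>.\<close>

lemma inverse_imageE:
  assumes "inverse_image u d0 d1 r0 r1 w"
    and u: "u \<in> Hom C U X" and d: "d0 \<in> Hom C T X" "d1 \<in> Hom C T X"
  obtains R where "r0 \<in> Hom C R U" "r1 \<in> Hom C R U" "w \<in> Hom C R T"
    "u \<cdot> r0 = d0 \<cdot> w" "u \<cdot> r1 = d1 \<cdot> w"
    "\<And>Z a b c. \<lbrakk>a \<in> Hom C Z U; b \<in> Hom C Z U; c \<in> Hom C Z T; u \<cdot> a = d0 \<cdot> c; u \<cdot> b = d1 \<cdot> c\<rbrakk>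
       \<Longrightarrow> \<exists>h\<in>Hom C Z R. r0 \<cdot> h = a \<and> r1 \<cdot> h = b \<and> w \<cdot> h = c"
proof -
  obtain R where r: "r0 \<in> Hom C R U" "r1 \<in> Hom C R U"
    and pb: "is_pullback (pair r0 r1) w (prod_map u u) (pair d0 d1)"
    using assms(1) Hom_DomCod[OF u] unfolding inverse_image_def by auto
  obtain R' where R': "pair r0 r1 \<in> Hom C R' (product U U)" "w \<in> Hom C R' T"
      "prod_map u u \<cdot> pair r0 r1 = pair d0 d1 \<cdot> w"
    and univ: "\<And>Z a b. \<lbrakk>a \<in> Hom C Z (product U U); b \<in> Hom C Z T; prod_map u u \<cdot> a = pair d0 d1 \<cdot> b\<rbrakk>
       \<Longrightarrow> \<exists>!h. h \<in> Hom C Z R' \<and> pair r0 r1 \<cdot> h = a \<and> w \<cdot> h = b"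
    by (rule is_pullbackE[OF pb prod_map_Hom[OF u u] pair_Hom[OF d]]) (rule that)
  have [simp]: "R' = R"
    using R'(1) pair_Hom[OF r] by (auto simp: Hom_def)
  have w: "w \<in> Hom C R T"
    using R' by simp
  have "pair (u \<cdot> r0) (u \<cdot> r1) = pair (d0 \<cdot> w) (d1 \<cdot> w)"
    using R'(3) prod_map_pair[OF u u r] pair_comp[OF d w] by simp
  then have eqs: "u \<cdot> r0 = d0 \<cdot> w" "u \<cdot> r1 = d1 \<cdot> w"
    using pair_eq_iff[OF Comp_in_Hom[OF r(1) u] Comp_in_Hom[OF r(2) u]
        Comp_in_Hom[OF w d(1)] Comp_in_Hom[OF w d(2)]] by simp_all
  show thesis
  proof (rule that[OF r w eqs])
    fix Z a b c
    assume *: "a \<in> Hom C Z U" "b \<in> Hom C Z U" "c \<in> Hom C Z T" "u \<cdot> a = d0 \<cdot> c" "u \<cdot> b = d1 \<cdot> c"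
    then have "prod_map u u \<cdot> pair a b = pair d0 d1 \<cdot> c"
      using prod_map_pair[OF u u *(1,2)] pair_comp[OF d *(3)] by simp
    then obtain h where h: "h \<in> Hom C Z R" "pair r0 r1 \<cdot> h = pair a b" "w \<cdot> h = c"
      using univ[OF pair_Hom[OF *(1,2)] *(3)] by auto
    then have "r0 \<cdot> h = a" "r1 \<cdot> h = b"
      using pair_comp[OF r h(1)] pair_eq_iff[of "r0 \<cdot> h" Z U "r1 \<cdot> h" U a b] *(1,2)
        Comp_in_Hom[OF h(1) r(1)] Comp_in_Hom[OF h(1) r(2)] by simp_all
    with h show "\<exists>h\<in>Hom C Z R. r0 \<cdot> h = a \<and> r1 \<cdot> h = b \<and> w \<cdot> h = c" by blast
  qed
qed

text \<open>The way back: every arrow into \<open>product U U\<close> is a pair, so a universal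
  property for such triples is the pullback property.\<close>

lemma inverse_imageI:
  assumes u: "u \<in> Hom C U X" and d: "d0 \<in> Hom C T X" "d1 \<in> Hom C T X"
    and r: "r0 \<in> Hom C R U" "r1 \<in> Hom C R U" and w: "w \<in> Hom C R T"
    and eqs: "u \<cdot> r0 = d0 \<cdot> w" "u \<cdot> r1 = d1 \<cdot> w"
    and univ: "\<And>Z a b c. \<lbrakk>a \<in> Hom C Z U; b \<in> Hom C Z U; c \<in> Hom C Z T; u \<cdot> a = d0 \<cdot> c; u \<cdot> b = d1 \<cdot> c\<rbrakk>
       \<Longrightarrow> \<exists>!h. h \<in> Hom C Z R \<and> r0 \<cdot> h = a \<and> r1 \<cdot> h = b \<and> w \<cdot> h = c"
  shows "inverse_image u d0 d1 r0 r1 w"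
  unfolding inverse_image_def Hom_DomCod[OF u]
proof (intro exI conjI)
  show "r0 \<in> Hom C R U" "r1 \<in> Hom C R U"
    using r by auto
  show "is_pullback (pair r0 r1) w (prod_map u u) (pair d0 d1)"
    using pair_Hom[OF r] prod_map_Hom[OF u u] w pair_Hom[OF d]
  proof (rule is_pullbackI)
    show "prod_map u u \<cdot> pair r0 r1 = pair d0 d1 \<cdot> w"
      using prod_map_pair[OF u u r] pair_comp[OF d w] eqs by simp
    fix Z ab c
    assume ab: "ab \<in> Hom C Z (product U U)" and c: "c \<in> Hom C Z T"
      and e: "prod_map u u \<cdot> ab = pair d0 d1 \<cdot> c"
    obtain a b where *: "a \<in> Hom C Z U" "b \<in> Hom C Z U" "ab = pair a b"
      using pair_surj[OF ab Hom_Obj(1)[OF u] Hom_Obj(1)[OF u]] .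
    have "pair (u \<cdot> a) (u \<cdot> b) = pair (d0 \<cdot> c) (d1 \<cdot> c)"
      using e prod_map_pair[OF u u *(1,2)] pair_comp[OF d c] *(3) by simp
    then have "u \<cdot> a = d0 \<cdot> c" "u \<cdot> b = d1 \<cdot> c"
      using pair_eq_iff[OF Comp_in_Hom[OF *(1) u] Comp_in_Hom[OF *(2) u]
          Comp_in_Hom[OF c d(1)] Comp_in_Hom[OF c d(2)]] by simp_all
    then have "\<exists>!h. h \<in> Hom C Z R \<and> r0 \<cdot> h = a \<and> r1 \<cdot> h = b \<and> w \<cdot> h = c"
      using univ * c by blast
    moreover have "pair r0 r1 \<cdot> h = ab \<longleftrightarrow> r0 \<cdot> h = a \<and> r1 \<cdot> h = b" if h: "h \<in> Hom C Z R" for h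
      using pair_comp[OF r h] pair_eq_iff[of "r0 \<cdot> h" Z U "r1 \<cdot> h" U a b] *
        Comp_in_Hom[OF h r(1)] Comp_in_Hom[OF h r(2)] by simp
    ultimately show "\<exists>!h. h \<in> Hom C Z R \<and> pair r0 r1 \<cdot> h = ab \<and> w \<cdot> h = c"
      by (metis (no_types, lifting))
  qed
qed

end

section \<open>Group structure on the hom-sets\<close>

context additive_category
begin

text \<open>The group law that generalized elements of an internal group inherit. The codomain
  stored in the first argument selects the addition.\<close>

definition plus :: "'a \<Rightarrow> 'a \<Rightarrow> 'a" (infixl "\<oplus>" 65) where
  "f \<oplus> g = add (Cod C f) \<cdot> pair f g"

definition null :: "'o \<Rightarrow> 'o \<Rightarrow> 'a" where
  "null Z X = zero X \<cdot> bang Z"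

definition minus :: "'a \<Rightarrow> 'a" where
  "minus f = neg (Cod C f) \<cdot> f"

lemma group_Hom:
  assumes "X \<in> Obj C"
  shows "add X \<in> Hom C (product X X) X" "zero X \<in> Hom C one X" "neg X \<in> Hom C X X"
  using group_structure[OF assms] by (auto simp: internal_group_def)

lemma plus_Hom: "\<lbrakk>f \<in> Hom C Z X; g \<in> Hom C Z X\<rbrakk> \<Longrightarrow> f \<oplus> g \<in> Hom C Z X"
  using Comp_in_Hom[OF pair_Hom group_Hom(1)] Hom_Obj(2) by (simp add: plus_def Hom_DomCod(2))

lemma null_Hom: "\<lbrakk>Z \<in> Obj C; X \<in> Obj C\<rbrakk> \<Longrightarrow> null Z X \<in> Hom C Z X"
  unfolding null_def by (rule Comp_in_Hom[OF bang_Hom group_Hom(2)])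

lemma minus_Hom: "f \<in> Hom C Z X \<Longrightarrow> minus f \<in> Hom C Z X"
  using Comp_in_Hom[OF _ group_Hom(3)] Hom_Obj(2) by (simp add: minus_def Hom_DomCod(2))

lemma plus_comp:
  assumes f: "f \<in> Hom C Z X" and g: "g \<in> Hom C Z X" and h: "h \<in> Hom C W Z"
  shows "(f \<oplus> g) \<cdot> h = f \<cdot> h \<oplus> g \<cdot> h"
  using Comp_assoc[OF h pair_Hom[OF f g] group_Hom(1)[OF Hom_Obj(2)[OF f]]] pair_comp[OF f g h]
    Hom_DomCod[OF f] Hom_DomCod[OF Comp_in_Hom[OF h f]]
  by (simp add: plus_def)

text \<open>Precomposition is additive for any internal group; additivity of postcomposition is
  where \<open>natural\<close> enters, since it says that \<open>h\<close> is a
  homomorphism.\<close>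

lemma comp_plus:
  assumes f: "f \<in> Hom C Z X" and g: "g \<in> Hom C Z X" and h: "h \<in> Hom C X Y"
  shows "h \<cdot> (f \<oplus> g) = h \<cdot> f \<oplus> h \<cdot> g"
proof -
  note o = Hom_Obj[OF h]
  have "h \<cdot> (f \<oplus> g) = (h \<cdot> add X) \<cdot> pair f g"
    using Comp_assoc[OF pair_Hom[OF f g] group_Hom(1)[OF o(1)] h] Hom_DomCod[OF f]
    by (simp add: plus_def)
  also have "\<dots> = add Y \<cdot> (prod_map h h \<cdot> pair f g)"
    using natural[OF h] Comp_assoc[OF pair_Hom[OF f g] prod_map_Hom[OF h h] group_Hom(1)[OF o(2)]]
    by simp
  also have "\<dots> = h \<cdot> f \<oplus> h \<cdot> g"
    using prod_map_pair[OF h h f g] Hom_DomCod[OF Comp_in_Hom[OF f h]] by (simp add: plus_def)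
  finally show ?thesis .
qed

lemma null_comp:
  assumes "h \<in> Hom C W Z" "X \<in> Obj C"
  shows "null Z X \<cdot> h = null W X"
proof -
  note o = Hom_Obj[OF assms(1)]
  have "bang Z \<cdot> h = bang W"
    using to_one_unique[OF Comp_in_Hom[OF assms(1) bang_Hom[OF o(2)]] bang_Hom[OF o(1)]] .
  then show ?thesis
    using Comp_assoc[OF assms(1) bang_Hom[OF o(2)] group_Hom(2)[OF assms(2)]]
    by (simp add: null_def)
qed

text \<open>The internal unit laws are the case of the generic element \<open>Ident C X\<close>;
  precomposing with \<open>f\<close> carries them to all generalized elements.\<close>

lemma plus_null:
  assumes f: "f \<in> Hom C Z X"
  shows plus_null_left: "null Z X \<oplus> f = f" and plus_null_right: "f \<oplus> null Z X = f"
proof -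
  note o = Hom_Obj[OF f]
  note I = Ident_in_Hom[OF o(2)] and N = null_Hom[OF o(2) o(2)]
  have "null X X \<oplus> Ident C X = Ident C X" "Ident C X \<oplus> null X X = Ident C X"
    using group_structure[OF o(2)] Hom_DomCod[OF I] Hom_DomCod[OF N]
    by (auto simp: internal_group_def plus_def null_def)
  then show "null Z X \<oplus> f = f" "f \<oplus> null Z X = f"
    using plus_comp[OF N I f] plus_comp[OF I N f] null_comp[OF f o(2)] Comp_Ident_left[OF f]
    by simp_all
qed

lemma plus_minus:
  assumes f: "f \<in> Hom C Z X"
  shows plus_minus_left: "minus f \<oplus> f = null Z X" and plus_minus_right: "f \<oplus> minus f = null Z X"
proof -
  note o = Hom_Obj[OF f]
  note I = Ident_in_Hom[OF o(2)] and N = group_Hom(3)[OF o(2)]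
  have "neg X \<oplus> Ident C X = null X X" "Ident C X \<oplus> neg X = null X X"
    using group_structure[OF o(2)] Hom_DomCod[OF I] Hom_DomCod[OF N]
    by (auto simp: internal_group_def plus_def null_def)
  then show "minus f \<oplus> f = null Z X" "f \<oplus> minus f = null Z X"
    using plus_comp[OF N I f] plus_comp[OF I N f] null_comp[OF f o(2)] Comp_Ident_left[OF f]
      Hom_DomCod[OF f]
    by (simp_all add: minus_def)
qed

lemma plus_assoc:
  assumes f: "f \<in> Hom C Z X" and g: "g \<in> Hom C Z X" and h: "h \<in> Hom C Z X"
  shows "(f \<oplus> g) \<oplus> h = f \<oplus> (g \<oplus> h)"
proof -
  note o = Hom_Obj(2)[OF f]
  note m = group_Hom(1)[OF o]
  have oo: "product X X \<in> Obj C"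
    using Hom_Obj(1)[OF m] .
  note I = Ident_in_Hom[OF o]
  note fg = pair_Hom[OF f g]
  note k = pair_Hom[OF fg h]
  note p = pr_Hom[OF o o] and P = pr_Hom[OF oo o]
  let ?l = "pr0 X X \<cdot> pr0 (product X X) X" and ?m = "pr1 X X \<cdot> pr0 (product X X) X"
    and ?r = "pr1 (product X X) X"
  have l: "?l \<in> Hom C (product (product X X) X) X" and m': "?m \<in> Hom C (product (product X X) X) X"
    using Comp_in_Hom[OF P(1) p(1)] Comp_in_Hom[OF P(1) p(2)] .
  have ev: "?l \<cdot> pair (pair f g) h = f" "?m \<cdot> pair (pair f g) h = g" "?r \<cdot> pair (pair f g) h = h"
    using Comp_assoc[OF k P(1) p(1)] Comp_assoc[OF k P(1) p(2)] pr0_pair[OF fg h] pr1_pair[OF fg h]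
      pr0_pair[OF f g] pr1_pair[OF f g] by simp_all
  \<comment> \<open>The internal law is associativity for the three generic projections
    \<open>?l\<close>, \<open>?m\<close>, \<open>?r\<close>; evaluating it at
    \<open>pair (pair f g) h\<close> yields the claim.\<close>
  have "add X \<cdot> prod_map (add X) (Ident C X) = ?l \<oplus> (?m \<oplus> ?r)"
    using group_structure[OF o] Hom_DomCod[OF l] Hom_DomCod[OF m']
    by (auto simp: internal_group_def plus_def)
  then have "(add X \<cdot> prod_map (add X) (Ident C X)) \<cdot> pair (pair f g) h = f \<oplus> (g \<oplus> h)"
    using plus_comp[OF l plus_Hom[OF m' P(2)] k] plus_comp[OF m' P(2) k] ev by simp
  moreover have "(add X \<cdot> prod_map (add X) (Ident C X)) \<cdot> pair (pair f g) h = (f \<oplus> g) \<oplus> h"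
    using Comp_assoc[OF k prod_map_Hom[OF m I] m] prod_map_pair[OF m I fg h] Comp_Ident_left[OF h]
      Hom_DomCod[OF f] Hom_DomCod[OF plus_Hom[OF f g]]
    by (simp add: plus_def)
  ultimately show ?thesis by simp
qed

lemma plus_left_cancel:
  assumes f: "f \<in> Hom C Z X" and g: "g \<in> Hom C Z X" and h: "h \<in> Hom C Z X" and "f \<oplus> g = f \<oplus> h"
  shows "g = h"
  using plus_assoc[OF minus_Hom[OF f] f g] plus_assoc[OF minus_Hom[OF f] f h]
    plus_minus_left[OF f] plus_null_left[OF g] plus_null_left[OF h] assms(4) by simp

text \<open>\<open>natural\<close> speaks only of addition, so preservation of zero is derived:
  \<open>h \<cdot> null Z X\<close> is idempotent, and cancellation makes it null.\<close>

lemma comp_null: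
  assumes h: "h \<in> Hom C X Y" and "Z \<in> Obj C"
  shows "h \<cdot> null Z X = null Z Y"
proof -
  note N = null_Hom[OF assms(2) Hom_Obj(1)[OF h]]
  note hN = Comp_in_Hom[OF N h]
  have "h \<cdot> null Z X \<oplus> h \<cdot> null Z X = h \<cdot> null Z X \<oplus> null Z Y"
    using comp_plus[OF N N h] plus_null_left[OF N] plus_null_right[OF hN] by simp
  then show ?thesis
    using plus_left_cancel[OF hN hN null_Hom[OF assms(2) Hom_Obj(2)[OF h]]] by blast
qed

section \<open>The congruence modulo a subobject\<close>

definition cong0 :: "'o \<Rightarrow> 'o \<Rightarrow> 'a" where
  "cong0 X I = pr0 X I"

text \<open>For monic \<open>m\<close> this encodes the pairs (x, y) with -x + y in the image of
  \<open>m\<close>: the second coordinate of \<open>product X I\<close> records that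
  difference.\<close>

definition cong1 :: "'o \<Rightarrow> 'o \<Rightarrow> 'a \<Rightarrow> 'a" where
  "cong1 X I m = pr0 X I \<oplus> m \<cdot> pr1 X I"

lemma cong_Hom:
  assumes "m \<in> Hom C I X"
  shows cong0_Hom: "cong0 X I \<in> Hom C (product X I) X"
    and cong1_Hom: "cong1 X I m \<in> Hom C (product X I) X"
  using pr_Hom[OF Hom_Obj(2,1)[OF assms]] plus_Hom[OF _ Comp_in_Hom[OF _ assms]]
  by (simp_all add: cong0_def cong1_def)

lemma cong_pair:
  assumes m: "m \<in> Hom C I X" and x: "x \<in> Hom C Z X" and i: "i \<in> Hom C Z I"
  shows cong0_pair: "cong0 X I \<cdot> pair x i = x"
    and cong1_pair: "cong1 X I m \<cdot> pair x i = x \<oplus> m \<cdot> i"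
proof -
  note pr = pr_Hom[OF Hom_Obj(2,1)[OF m]] and xi = pair_Hom[OF x i]
  show "cong0 X I \<cdot> pair x i = x"
    using pr0_pair[OF x i] by (simp add: cong0_def)
  show "cong1 X I m \<cdot> pair x i = x \<oplus> m \<cdot> i"
    using plus_comp[OF pr(1) Comp_in_Hom[OF pr(2) m] xi] Comp_assoc[OF xi pr(2) m]
      pr0_pair[OF x i] pr1_pair[OF x i] by (simp add: cong1_def)
qed

text \<open>Reflexivity, symmetry and transitivity come from the translations
  \<open>m \<cdot> i\<close> containing zero and being closed under negation and sum. That
  \<open>m\<close> is monic lets the endpoints determine \<open>i\<close>.\<close>

lemma internal_equivalence_cong:
  assumes "monic I X m"
  shows "internal_equivalence X (cong0 X I) (cong1 X I m)"
proof -
  have m: "m \<in> Hom C I X"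
    and inj: "\<And>Z g h. \<lbrakk>g \<in> Hom C Z I; h \<in> Hom C Z I; m \<cdot> g = m \<cdot> h\<rbrakk> \<Longrightarrow> g = h"
    using assms unfolding monic_def by blast+
  note o = Hom_Obj(2,1)[OF m]
  let ?T = "product X I" and ?d0 = "cong0 X I" and ?d1 = "cong1 X I m"
  note d = cong_Hom[OF m]
  note ev = cong_pair[OF m]
  have DT: "Dom C ?d0 = ?T"
    using Hom_DomCod[OF d(1)] by simp
  have T: "?T \<in> Obj C"
    using Hom_Obj[OF d(1)] by simp
  have "g = h" if gh: "g \<in> Hom C Z ?T" "h \<in> Hom C Z ?T" "?d0 \<cdot> g = ?d0 \<cdot> h" "?d1 \<cdot> g = ?d1 \<cdot> h"
    for Z g h
  proof -
    obtain x i where g: "x \<in> Hom C Z X" "i \<in> Hom C Z I" "g = pair x i"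
      using pair_surj[OF gh(1) o] .
    obtain y j where h: "y \<in> Hom C Z X" "j \<in> Hom C Z I" "h = pair y j"
      using pair_surj[OF gh(2) o] .
    have "x = y" and "x \<oplus> m \<cdot> i = y \<oplus> m \<cdot> j"
      using gh(3,4) ev(1)[OF g(1,2)] ev(1)[OF h(1,2)] ev(2)[OF g(1,2)] ev(2)[OF h(1,2)] g(3) h(3)
      by auto
    then have "m \<cdot> i = m \<cdot> j"
      using plus_left_cancel[OF g(1) Comp_in_Hom[OF g(2) m] Comp_in_Hom[OF h(2) m]] by simp
    then show ?thesis
      using inj g h \<open>x = y\<close> by blast
  qed
  then have rel: "internal_relation X ?d0 ?d1"
    unfolding internal_relation_def using d by blast
  have refl: "\<exists>s\<in>Hom C X ?T. ?d0 \<cdot> s = Ident C X \<and> ?d1 \<cdot> s = Ident C X"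
  proof -
    note I = Ident_in_Hom[OF o(1)] and N = null_Hom[OF o]
    have "?d1 \<cdot> pair (Ident C X) (null X I) = Ident C X"
      using ev(2)[OF I N] comp_null[OF m o(1)] plus_null_right[OF I] by simp
    then show ?thesis
      using ev(1)[OF I N] pair_Hom[OF I N] by blast
  qed
  have sym: "\<exists>s\<in>Hom C ?T ?T. ?d0 \<cdot> s = ?d1 \<and> ?d1 \<cdot> s = ?d0"
  proof -
    note pr = pr_Hom[OF o]
    note i = pr(2) and i' = minus_Hom[OF pr(2)]
    note mi = Comp_in_Hom[OF i m] and mi' = Comp_in_Hom[OF i' m]
    \<comment> \<open>The swap sends (x, i) to (x + m i, -i). At the generic element the new base
      point is \<open>?d1\<close> itself.\<close>
    have "?d1 \<cdot> pair ?d1 (minus (pr1 X I)) = (pr0 X I \<oplus> m \<cdot> pr1 X I) \<oplus> m \<cdot> minus (pr1 X I)"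
      using ev(2)[OF d(2) i'] by (simp add: cong1_def)
    also have "\<dots> = pr0 X I \<oplus> m \<cdot> (pr1 X I \<oplus> minus (pr1 X I))"
      using plus_assoc[OF pr(1) mi mi'] comp_plus[OF i i' m] by simp
    also have "\<dots> = ?d0"
      using plus_minus_right[OF i] comp_null[OF m T] plus_null_right[OF pr(1)]
      by (simp add: cong0_def)
    finally show ?thesis
      using ev(1)[OF d(2) i'] pair_Hom[OF d(2) i'] by blast
  qed
  have trans: "\<exists>t\<in>Hom C (Dom C p) ?T. ?d0 \<cdot> t = ?d0 \<cdot> p \<and> ?d1 \<cdot> t = ?d1 \<cdot> q"
    if pb: "is_pullback p q ?d1 ?d0" for p q
  proof -
    obtain P where P: "p \<in> Hom C P ?T" "q \<in> Hom C P ?T" "?d1 \<cdot> p = ?d0 \<cdot> q"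
      by (rule is_pullbackE[OF pb d(2,1)]) (rule that)
    obtain x i where p: "x \<in> Hom C P X" "i \<in> Hom C P I" "p = pair x i"
      using pair_surj[OF P(1) o] .
    obtain y j where q: "y \<in> Hom C P X" "j \<in> Hom C P I" "q = pair y j"
      using pair_surj[OF P(2) o] .
    have y: "y = x \<oplus> m \<cdot> i"
      using P(3) ev(2)[OF p(1,2)] ev(1)[OF q(1,2)] p(3) q(3) by simp
    note ij = plus_Hom[OF p(2) q(2)]
    \<comment> \<open>The second pair starts where the first ends, so the composite starts at
      \<open>x\<close> and its translations add up.\<close>
    have "?d1 \<cdot> pair x (i \<oplus> j) = ?d1 \<cdot> q"
      using ev(2)[OF p(1) ij] ev(2)[OF q(1,2)] comp_plus[OF p(2) q(2) m]
        plus_assoc[OF p(1) Comp_in_Hom[OF p(2) m] Comp_in_Hom[OF q(2) m]] y q(3) by simp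
    moreover have "?d0 \<cdot> pair x (i \<oplus> j) = ?d0 \<cdot> p"
      using ev(1)[OF p(1) ij] ev(1)[OF p(1,2)] p(3) by simp
    ultimately show ?thesis
      using pair_Hom[OF p(1) ij] Hom_DomCod[OF P(1)] by auto
  qed
  show ?thesis
    unfolding internal_equivalence_def DT using rel refl sym trans by blast
qed

text \<open>Translations by elements of \<open>I\<close> stay inside \<open>U\<close>, since
  \<open>m\<close> is here \<open>u \<cdot> k\<close>. Hence a pair with first endpoint in
  \<open>U\<close> lies wholly in \<open>U\<close>, and the pullback along the first projection
  already is the inverse image, namely the congruence modulo \<open>k\<close>.\<close>

lemma cong_inverse_image:
  assumes "monic U X u" and k: "k \<in> Hom C I U"
  defines "w \<equiv> pair (u \<cdot> cong0 U I) (pr1 U I)"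
  shows "inverse_image u (cong0 X I) (cong1 X I (u \<cdot> k)) (cong0 U I) (cong1 U I k) w"
    and "is_pullback (cong0 U I) w u (cong0 X I)"
proof -
  have u: "u \<in> Hom C U X"
    and inj: "\<And>Z g h. \<lbrakk>g \<in> Hom C Z U; h \<in> Hom C Z U; u \<cdot> g = u \<cdot> h\<rbrakk> \<Longrightarrow> g = h"
    using assms unfolding monic_def by blast+
  note m = Comp_in_Hom[OF k u]
  note o = Hom_Obj(2,1)[OF k] and oX = Hom_Obj(2)[OF u]
  note pr = pr_Hom[OF o]
  note d = cong_Hom[OF m] and r = cong_Hom[OF k]
  note evd = cong_pair[OF m] and evr = cong_pair[OF k]
  note ur = Comp_in_Hom[OF r(1) u]
  have w: "w \<in> Hom C (product U I) (product X I)"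
    unfolding w_def using pair_Hom[OF ur pr(2)] .
  have w_pair: "w \<cdot> pair a i = pair (u \<cdot> a) i" if a: "a \<in> Hom C Z U" and i: "i \<in> Hom C Z I" for Z a i
    using pair_comp[OF ur pr(2) pair_Hom[OF a i]] Comp_assoc[OF pair_Hom[OF a i] r(1) u]
      evr(1)[OF a i] pr1_pair[OF a i] by (simp add: w_def)
  have e0: "u \<cdot> cong0 U I = cong0 X I \<cdot> w"
    using evd(1)[OF ur pr(2)] by (simp add: w_def)
  have e1: "u \<cdot> cong1 U I k = cong1 X I (u \<cdot> k) \<cdot> w"
    using evd(2)[OF ur pr(2)] comp_plus[OF pr(1) Comp_in_Hom[OF pr(2) k] u] Comp_assoc[OF pr(2) k u]
    by (simp add: w_def cong0_def cong1_def)
  have univ: "\<exists>!h. h \<in> Hom C Z (product U I) \<and> cong0 U I \<cdot> h = a \<and> w \<cdot> h = c"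
    if a: "a \<in> Hom C Z U" and c: "c \<in> Hom C Z (product X I)" and e: "u \<cdot> a = cong0 X I \<cdot> c" for Z a c
  proof -
    obtain x i where x: "x \<in> Hom C Z X" and i: "i \<in> Hom C Z I" and ci: "c = pair x i"
      using pair_surj[OF c oX o(2)] .
    have xa: "x = u \<cdot> a"
      using e evd(1)[OF x i] ci by simp
    show ?thesis
    proof (rule ex1I[of _ "pair a i"])
      show "pair a i \<in> Hom C Z (product U I) \<and> cong0 U I \<cdot> pair a i = a \<and> w \<cdot> pair a i = c"
        using pair_Hom[OF a i] evr(1)[OF a i] w_pair[OF a i] ci xa by simp
      fix h assume h: "h \<in> Hom C Z (product U I) \<and> cong0 U I \<cdot> h = a \<and> w \<cdot> h = c"
      then obtain b j where b: "b \<in> Hom C Z U" and j: "j \<in> Hom C Z I" and hb: "h = pair b j"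
        using pair_surj[OF _ o, of h Z] by blast
      have "b = a"
        using h evr(1)[OF b j] hb by simp
      moreover have "pair (u \<cdot> b) j = pair x i"
        using h w_pair[OF b j] ci hb by simp
      then have "j = i"
        using pair_eq_iff[OF Comp_in_Hom[OF b u] j x i] by simp
      ultimately show "h = pair a i"
        using hb by simp
    qed
  qed
  show "is_pullback (cong0 U I) w u (cong0 X I)"
    by (rule is_pullbackI[OF r(1) u w d(1) e0 univ])
  show "inverse_image u (cong0 X I) (cong1 X I (u \<cdot> k)) (cong0 U I) (cong1 U I k) w"
  proof (rule inverse_imageI[OF u d r w e0 e1])
    fix Z a b c
    assume a: "a \<in> Hom C Z U" and b: "b \<in> Hom C Z U" and c: "c \<in> Hom C Z (product X I)"
      and e: "u \<cdot> a = cong0 X I \<cdot> c" and e': "u \<cdot> b = cong1 X I (u \<cdot> k) \<cdot> c"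
    \<comment> \<open>The second endpoint takes care of itself: both sides agree after
      \<open>u\<close>, which is monic.\<close>
    have "cong1 U I k \<cdot> h = b" if h: "h \<in> Hom C Z (product U I)" "w \<cdot> h = c" for h
    proof -
      have "u \<cdot> (cong1 U I k \<cdot> h) = u \<cdot> b"
        using Comp_assoc[OF h(1) r(2) u] Comp_assoc[OF h(1) w d(2)] e1 e' h(2) by simp
      then show ?thesis
        using inj[OF Comp_in_Hom[OF h(1) r(2)] b] by blast
    qed
    then show "\<exists>!h. h \<in> Hom C Z (product U I) \<and> cong0 U I \<cdot> h = a \<and> cong1 U I k \<cdot> h = b \<and> w \<cdot> h = c"
      using univ[OF a c e] by (metis (no_types, lifting))
  qed
qed

section \<open>The largest saturating equivalence relation\<close>

lemma largest_saturating_congruence: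
  assumes mu: "monic U X u" and S: "internal_equivalence U s0 s1"
  shows "\<exists>t0 t1. internal_equivalence X t0 t1 \<and> saturated u t0 t1 \<and> inverse_image_le u t0 t1 s0 s1 \<and>
       (\<forall>d0 d1. internal_equivalence X d0 d1 \<and> saturated u d0 d1 \<and> inverse_image_le u d0 d1 s0 s1
          \<longrightarrow> relation_le d0 d1 t0 t1)"
proof -
  have u: "u \<in> Hom C U X"
    and inj: "\<And>Z g h. \<lbrakk>g \<in> Hom C Z U; h \<in> Hom C Z U; u \<cdot> g = u \<cdot> h\<rbrakk> \<Longrightarrow> g = h"
    using mu unfolding monic_def by blast+
  note o = Hom_Obj[OF u]
  obtain Q where s: "s0 \<in> Hom C Q U" "s1 \<in> Hom C Q U"
    and s_inj: "\<And>Z g h. \<lbrakk>g \<in> Hom C Z Q; h \<in> Hom C Z Q; s0 \<cdot> g = s0 \<cdot> h; s1 \<cdot> g = s1 \<cdot> h\<rbrakk> \<Longrightarrow> g = h"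
    using S unfolding internal_equivalence_def internal_relation_def by blast
  have DQ: "Dom C s0 = Q"
    using Hom_DomCod[OF s(1)] by simp
  obtain \<rho> where \<rho>: "\<rho> \<in> Hom C U Q" "s0 \<cdot> \<rho> = Ident C U" "s1 \<cdot> \<rho> = Ident C U"
    using S DQ unfolding internal_equivalence_def by auto
  have Q: "Q \<in> Obj C"
    using Hom_Obj[OF s(1)] by simp
  \<comment> \<open>\<open>I\<close> consists of the pairs (0, y) in S, cut out of \<open>Q\<close>
    by equalizing \<open>s0\<close> with the null arrow; \<open>k\<close> below extracts y.\<close>
  obtain I \<kappa> where \<kappa>: "\<kappa> \<in> Hom C I Q" "s0 \<cdot> \<kappa> = null Q U \<cdot> \<kappa>"
    and ker: "\<And>Z a. \<lbrakk>a \<in> Hom C Z Q; s0 \<cdot> a = null Q U \<cdot> a\<rbrakk> \<Longrightarrow> \<exists>!h. h \<in> Hom C Z I \<and> \<kappa> \<cdot> h = a"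
    by (rule equalizer_exists[OF s(1) null_Hom[OF Q o(1)]]) (rule that)
  have I: "I \<in> Obj C"
    using Hom_Obj[OF \<kappa>(1)] by simp
  have s0\<kappa>: "s0 \<cdot> \<kappa> = null I U"
    using \<kappa> null_comp[OF \<kappa>(1) o(1)] by simp
  define k where "k = s1 \<cdot> \<kappa>"
  have k: "k \<in> Hom C I U"
    unfolding k_def using Comp_in_Hom[OF \<kappa>(1) s(2)] .
  note m = Comp_in_Hom[OF k u]
  \<comment> \<open>Elements of \<open>I\<close> have null first component, so the second determines
    them in \<open>Q\<close> by joint monicity; uniqueness in \<open>ker\<close> then gives equality
    in \<open>I\<close>.\<close>
  have "monic I X (u \<cdot> k)"
    unfolding monic_def
  proof (intro conjI allI ballI impI m)
    fix Z g h assume g: "g \<in> Hom C Z I" and h: "h \<in> Hom C Z I" and "(u \<cdot> k) \<cdot> g = (u \<cdot> k) \<cdot> h"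
    then have "k \<cdot> g = k \<cdot> h"
      using inj Comp_in_Hom[OF g k] Comp_in_Hom[OF h k] Comp_assoc[OF g k u] Comp_assoc[OF h k u]
      by simp
    then have "s1 \<cdot> (\<kappa> \<cdot> g) = s1 \<cdot> (\<kappa> \<cdot> h)"
      using Comp_assoc[OF g \<kappa>(1) s(2)] Comp_assoc[OF h \<kappa>(1) s(2)] by (simp add: k_def)
    moreover have s0: "s0 \<cdot> (\<kappa> \<cdot> g) = null Z U" "s0 \<cdot> (\<kappa> \<cdot> h) = null Z U"
      using Comp_assoc[OF g \<kappa>(1) s(1)] Comp_assoc[OF h \<kappa>(1) s(1)] s0\<kappa>
        null_comp[OF g o(1)] null_comp[OF h o(1)] by auto
    ultimately have \<kappa>gh: "\<kappa> \<cdot> g = \<kappa> \<cdot> h"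
      using s_inj Comp_in_Hom[OF g \<kappa>(1)] Comp_in_Hom[OF h \<kappa>(1)] by simp
    have "s0 \<cdot> (\<kappa> \<cdot> g) = null Q U \<cdot> (\<kappa> \<cdot> g)"
      using s0 null_comp[OF Comp_in_Hom[OF g \<kappa>(1)] o(1)] by simp
    from ker[OF Comp_in_Hom[OF g \<kappa>(1)] this] show "g = h"
      using \<kappa>gh g h by auto
  qed
  then have equ: "internal_equivalence X (cong0 X I) (cong1 X I (u \<cdot> k))"
    by (rule internal_equivalence_cong)
  note inv = cong_inverse_image[OF mu k]
  have sat: "saturated u (cong0 X I) (cong1 X I (u \<cdot> k))"
    unfolding saturated_def using inv by blast
  have "relation_le (cong0 U I) (cong1 U I k) s0 s1"
  proof -
    note pr = pr_Hom[OF o(1) I]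
    \<comment> \<open>The sum in \<open>Q\<close> of the pairs (a, a) and (0, k i), which is (a, a +
      k i) because \<open>s0\<close> and \<open>s1\<close> are additive.\<close>
    define j where "j = \<rho> \<cdot> pr0 U I \<oplus> \<kappa> \<cdot> pr1 U I"
    note a = Comp_in_Hom[OF pr(1) \<rho>(1)] and b = Comp_in_Hom[OF pr(2) \<kappa>(1)]
    have "s0 \<cdot> j = pr0 U I \<oplus> null (product U I) U" "s1 \<cdot> j = pr0 U I \<oplus> k \<cdot> pr1 U I"
      using comp_plus[OF a b s(1)] comp_plus[OF a b s(2)]
        Comp_assoc[OF pr(1) \<rho>(1) s(1)] Comp_assoc[OF pr(1) \<rho>(1) s(2)]
        Comp_assoc[OF pr(2) \<kappa>(1) s(1)] Comp_assoc[OF pr(2) \<kappa>(1) s(2)]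
        \<rho>(2,3) Comp_Ident_left[OF pr(1)] s0\<kappa> null_comp[OF pr(2) o(1)]
      by (simp_all add: j_def k_def)
    then have "s0 \<cdot> j = cong0 U I" "s1 \<cdot> j = cong1 U I k"
      using plus_null_right[OF pr(1)] by (simp_all add: cong0_def cong1_def)
    moreover have "j \<in> Hom C (product U I) Q"
      unfolding j_def using plus_Hom[OF a b] .
    ultimately show ?thesis
      unfolding relation_le_def DQ using Hom_DomCod[OF cong0_Hom[OF k]] by auto
  qed
  then have le: "inverse_image_le u (cong0 X I) (cong1 X I (u \<cdot> k)) s0 s1"
    unfolding inverse_image_le_def using inv by blast
  have "relation_le d0 d1 (cong0 X I) (cong1 X I (u \<cdot> k))"
    if D: "internal_equivalence X d0 d1" "saturated u d0 d1" "inverse_image_le u d0 d1 s0 s1" for d0 d1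
  proof -
    obtain T where d: "d0 \<in> Hom C T X" "d1 \<in> Hom C T X"
      using D(1) unfolding internal_equivalence_def internal_relation_def by blast
    have DT: "Dom C d0 = T" and T: "T \<in> Obj C"
      using Hom_DomCod[OF d(1)] Hom_Obj[OF d(1)] by simp_all
    obtain \<delta> where \<delta>: "\<delta> \<in> Hom C X T" "d0 \<cdot> \<delta> = Ident C X" "d1 \<cdot> \<delta> = Ident C X"
      using D(1) DT unfolding internal_equivalence_def by auto
    \<comment> \<open>\<open>g\<close> sends the pair (x, y) to (x, x).\<close>
    define g where "g = \<delta> \<cdot> d0"
    have g: "g \<in> Hom C T T" "d0 \<cdot> g = d0" "d1 \<cdot> g = d0"
      using Comp_in_Hom[OF d(1) \<delta>(1)] Comp_assoc[OF d(1) \<delta>(1) d(1)] Comp_assoc[OF d(1) \<delta>(1) d(2)]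
        \<delta> Comp_Ident_left[OF d(1)] by (simp_all add: g_def)
    \<comment> \<open>translate the pair \<open>(x, y)\<close> in \<open>T\<close> to \<open>(0, - x + y)\<close>\<close>
    define h where "h = minus g \<oplus> Ident C T"
    note IT = Ident_in_Hom[OF T] and g' = minus_Hom[OF g(1)]
    have h: "h \<in> Hom C T T"
      unfolding h_def using plus_Hom[OF g' IT] .
    have "d0 \<cdot> h = d0 \<cdot> minus g \<oplus> d0 \<cdot> g"
      using comp_plus[OF g' IT d(1)] Comp_Ident_right[OF d(1)] g(2) by (simp add: h_def)
    also have "\<dots> = null T X"
      using comp_plus[OF g' g(1) d(1)] plus_minus_left[OF g(1)] comp_null[OF d(1) T] by simp
    finally have d0h: "d0 \<cdot> h = null T X" .
    \<comment> \<open>(x, x) + (0, -x + y) = (x, y); applying \<open>d1\<close> recovers y from x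
      and the second endpoint of \<open>h\<close>.\<close>
    have "g \<oplus> h = Ident C T"
      unfolding h_def using plus_assoc[OF g(1) g' IT] plus_minus_right[OF g(1)] plus_null_left[OF IT]
      by simp
    then have d1h: "d0 \<oplus> d1 \<cdot> h = d1"
      using comp_plus[OF g(1) h d(2)] g(3) Comp_Ident_right[OF d(2)] by simp
    obtain r0 r1 w where r: "inverse_image u d0 d1 r0 r1 w" and pb: "is_pullback r0 w u d0"
      using D(2) unfolding saturated_def by blast
    note N = null_Hom[OF T o(1)]
    have uN: "u \<cdot> null T U = d0 \<cdot> h"
      using comp_null[OF u T] d0h by simp
    obtain R where R: "r0 \<in> Hom C R U" "r1 \<in> Hom C R U" "w \<in> Hom C R T" "u \<cdot> r1 = d1 \<cdot> w"
      by (rule inverse_imageE[OF r u d]) (rule that)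
    \<comment> \<open>Saturation at work: the first endpoint of \<open>h\<close> is zero, hence
      comes from \<open>U\<close>, so \<open>h\<close> lifts to the inverse image and its second
      endpoint \<open>d1 \<cdot> h\<close> also comes from \<open>U\<close>, as
      \<open>b\<close>.\<close>
    obtain f where f: "f \<in> Hom C T R" "w \<cdot> f = h"
    proof (rule is_pullbackE[OF pb u d(1)])
      fix P assume P: "r0 \<in> Hom C P U"
        and univ: "\<And>Z a b. \<lbrakk>a \<in> Hom C Z U; b \<in> Hom C Z T; u \<cdot> a = d0 \<cdot> b\<rbrakk>
          \<Longrightarrow> \<exists>!h. h \<in> Hom C Z P \<and> r0 \<cdot> h = a \<and> w \<cdot> h = b"
      have "P = R"
        using Hom_DomCod[OF P] Hom_DomCod[OF R(1)] by simp
      with univ[OF N h uN] that show thesis by blast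
    qed
    define b where "b = r1 \<cdot> f"
    have b: "b \<in> Hom C T U"
      unfolding b_def using Comp_in_Hom[OF f(1) R(2)] .
    have ub: "u \<cdot> b = d1 \<cdot> h"
      using Comp_assoc[OF f(1) R(2) u] Comp_assoc[OF f(1) R(3) d(2)] R(4) f(2) by (simp add: b_def)
    \<comment> \<open>The inverse image witnessing inclusion in S is chosen independently of the one
      for saturation, so the pair (0, b) over \<open>h\<close> is lifted again through its universal
      property.\<close>
    obtain r0' r1' w' where r': "inverse_image u d0 d1 r0' r1' w'" and le: "relation_le r0' r1' s0 s1"
      using D(3) unfolding inverse_image_le_def by blast
    obtain R' where R': "r0' \<in> Hom C R' U"
      and univ: "\<And>Z a b c. \<lbrakk>a \<in> Hom C Z U; b \<in> Hom C Z U; c \<in> Hom C Z T; u \<cdot> a = d0 \<cdot> c; u \<cdot> b = d1 \<cdot> c\<rbrakk>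
        \<Longrightarrow> \<exists>h\<in>Hom C Z R'. r0' \<cdot> h = a \<and> r1' \<cdot> h = b \<and> w' \<cdot> h = c"
      by (rule inverse_imageE[OF r' u d]) (rule that)
    obtain e where e: "e \<in> Hom C T R'" "r0' \<cdot> e = null T U" "r1' \<cdot> e = b"
      using univ[OF N b h uN ub] by blast
    obtain j where j: "j \<in> Hom C R' Q" "s0 \<cdot> j = r0'" "s1 \<cdot> j = r1'"
      using le Hom_DomCod[OF R'] DQ unfolding relation_le_def by auto
    note je = Comp_in_Hom[OF e(1) j(1)]
    have s0je: "s0 \<cdot> (j \<cdot> e) = null T U" and s1je: "s1 \<cdot> (j \<cdot> e) = b"
      using Comp_assoc[OF e(1) j(1) s(1)] Comp_assoc[OF e(1) j(1) s(2)] j e by simp_all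
    \<comment> \<open>The pair (0, b) now lies in S, so it factors through \<open>\<kappa>\<close>,
      and \<open>b\<close> is \<open>k\<close> applied to some \<open>i\<close>.\<close>
    have "s0 \<cdot> (j \<cdot> e) = null Q U \<cdot> (j \<cdot> e)"
      using s0je null_comp[OF je o(1)] by simp
    then obtain i where i: "i \<in> Hom C T I" "\<kappa> \<cdot> i = j \<cdot> e"
      using ker[OF je] by blast
    have "(u \<cdot> k) \<cdot> i = u \<cdot> b"
      using Comp_assoc[OF i(1) k u] Comp_assoc[OF i(1) \<kappa>(1) s(2)] i(2) s1je by (simp add: k_def)
    \<comment> \<open>Translating \<open>d0\<close> by \<open>u \<cdot> b\<close>, which is
      \<open>d1 \<cdot> h\<close>, gives \<open>d1\<close>; so \<open>pair d0 i\<close> is the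
      required factorisation.\<close>
    then have "cong1 X I (u \<cdot> k) \<cdot> pair d0 i = d1"
      using cong1_pair[OF m d(1) i(1)] ub d1h by simp
    then show ?thesis
      unfolding relation_le_def
      using cong0_pair[OF m d(1) i(1)] pair_Hom[OF d(1) i(1)] DT Hom_DomCod[OF cong0_Hom[OF m]]
      by auto
  qed
  then show ?thesis
    using equ sat le by blast
qed

end

theorem proposition4p8:
  fixes E :: "('o, 'a) cat"
    and add zero neg :: "'o \<Rightarrow> 'a"
  assumes "additive_category E add zero neg"
  shows "Equ_saturating_category E"
proof -
  interpret additive_category E add zero neg
    by (rule assms)
  show ?thesis
    by unfold_locales (rule largest_saturating_congruence)
qed

end
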